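(* Let $\mathbf y\in\mathbb R^n$ and let $X=(\mathbf x_1,\dots,\mathbf x_m)$ be an $n\times m$ real matrix with linearly independent columns, standardized so that $\sum_i y_i=0$, $\sum_i x_{ij}=0$, $\sum_i x_{ij}^2=1$ for all $j$. Suppose that the Lasso-modified LARS algorithm (defined in the context), run on $(X,\mathbf y)$, satisfies the "one at a time" condition (defined in the context). Then the Lasso-modified LARS algorithm yields all Lasso solutions: the set of coefficient vectors $\widehat{\boldsymbol\beta}$ traced out by the algorithm equals $\{\widehat{\boldsymbol\beta}(t): t\ge 0\}$, where $\widehat{\boldsymbol\beta}(t)$ denotes the (unique) solution of the Lasso problem: minimize $\|\mathbf y-X\boldsymbol\beta\|^2$ subject to $\sum_{j=1}^m|\beta_j|\le t$.
   Context: For a nonempty set $\mathcal A\subseteq\{1,\dots,m\}$ and signs $s_j\in\{\pm1\}$ $(j\in\mathcal A)$ put $X_{\mathcal A}=(\cdots s_j\mathbf x_j\cdots)_{j\in\mathcal A}$, $\mathcal G_{\mathcal A}=X_{\mathcal A}'X_{\mathcal A}$, $A_{\mathcal A}=(\mathbf 1_{\mathcal A}'\mathcal G_{\mathcal A}^{-1}\mathbf 1_{\mathcal A})^{-1/2}$, $w_{\mathcal A}=A_{\mathcal A}\mathcal G_{\mathcal A}^{-1}\mathbf 1_{\mathcal A}$ and $\mathbf u_{\mathcal A}=X_{\mathcal A}w_{\mathcal A}$ (the equiangular vector), where $\mathbf 1_{\mathcal A}$ is the vector of ones of length $|\mathcal A|$. Lasso-modified LARS algorithm. Start with $\widehat{\boldsymbol\beta}=0$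 and $\mathcal A=\{j:|\hat c_j|=\widehat C\}$, where at any current $\widehat{\boldsymbol\beta}$ we write $\widehat{\boldsymbol\mu}=X\widehat{\boldsymbol\beta}$, $\hat{\mathbf c}=X'(\mathbf y-\widehat{\boldsymbol\mu})$ (the current correlations) and $\widehat C=\max_j|\hat c_j|$. While $\widehat C>0$, perform a step as follows. Let $s_j=\operatorname{sign}(\hat c_j)$ for $j\in\mathcal A$, form $X_{\mathcal A},A_{\mathcal A},w_{\mathcal A},\mathbf u_{\mathcal A}$, and let $\mathbf a=X'\mathbf u_{\mathcal A}$. Let $$\hat\gamma=\min_{j\in\mathcal A^c}{}^{+}\left\{\frac{\widehat C-\hat c_j}{A_{\mathcal A}-a_j},\ \frac{\widehat C+\hat c_j}{A_{\mathcal A}+a_j}\right\},$$ where $\min^+$ means that only the quotients that are defined and positive are considered; if $\mathcal A=\{1,\dots,m\}$ put $\hat\gamma=\widehat C/A_{\mathcal A}$. Let $\hat{\mathbf d}\in\mathbb R^m$ have $\hat d_j=s_jw_{\mathcal Aj}$ for $j\in\mathcal A$ and $\hat d_j=0$ otherwise. Let $\gamma_j=-\hat\beta_j/\hat d_j$ for $j\in\mathcal A$ with $\hat d_j\neq 0$, and $\tilde\gamma=\min_{\gamma_j>0}\gamma_j$ ($=\infty$ if there is no $\gamma_j>0$). The step traces the segment $\{\widehat{\boldsymbol\beta}+\gamma\hat{\mathbf d}:0\le\gamma\le\min(\hat\gamma,\tilde\gamma)\}$ (so the prediction moves as $\widehat{\boldsymbol\mu}+\gamma\mathbf u_{\mathcal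 A}$), and $\widehat{\boldsymbol\beta}$ is replaced by the endpoint of the segment. If $\tilde\gamma<\hat\gamma$, then $\mathcal A$ is replaced by $\mathcal A\setminus\{\tilde j\}$, where $\tilde j$ attains $\tilde\gamma$; otherwise $\mathcal A$ is replaced by $\mathcal A\cup\{\hat j\}$, where $\hat j$ attains $\hat\gamma$. The algorithm stops when $\widehat C=0$. "One at a time" condition: increases and decreases of the active set $\mathcal A$ never involve more than a single index. That is, if $\widehat C>0$ initially then the initial active set is a singleton, and at the end of each step at which still $\widehat C>0$, exactly one index is either added to or deleted from the active set, without ties (the index attaining the minimum is unique, and $\tilde\gamma\ne\hat\gamma$); equivalently, at each such breakpoint exactly one index $j$ has $\hat\beta_j=0$ and $|\hat c_j|=\widehat C$. *)

theory Defs
  imports "HOL-Analysis.Analysis"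
begin

text \<open>
  The design matrix is \<open>X :: real ^ 'm ^ 'n\<close>: rows (observations) are indexed by \<open>'n\<close>, columns
  (covariates) by \<open>'m\<close>.
\<close>

definition lasso_solution :: "real ^ 'm ^ 'n \<Rightarrow> real ^ 'n \<Rightarrow> real \<Rightarrow> real ^ 'm \<Rightarrow> bool" where
  "lasso_solution X y t \<beta> \<longleftrightarrow>
     is_arg_min (\<lambda>b. (norm (y - X *v b))\<^sup>2) (\<lambda>b. (\<Sum>j\<in>UNIV. \<bar>b $ j\<bar>) \<le> t) \<beta>"

definition lasso :: "real ^ 'm ^ 'n \<Rightarrow> real ^ 'n \<Rightarrow> real \<Rightarrow> real ^ 'm" where
  "lasso X y t = (THE \<beta>. lasso_solution X y t \<beta>)"


definition corr :: "real ^ 'm ^ 'n \<Rightarrow> real ^ 'n \<Rightarrow> real ^ 'm \<Rightarrow> real ^ 'm" where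
  "corr X y \<beta> = transpose X *v (y - X *v \<beta>)"

definition max_corr :: "real ^ 'm ^ 'n \<Rightarrow> real ^ 'n \<Rightarrow> real ^ 'm \<Rightarrow> real" where
  "max_corr X y \<beta> = Max (range (\<lambda>j. \<bar>corr X y \<beta> $ j\<bar>))"


text \<open>
  Vectors and matrices indexed by an active set \<open>A\<close> are padded with zeros to the full index
  type \<open>'m\<close>.
\<close>

definition ones_on :: "'m set \<Rightarrow> real ^ 'm" where
  "ones_on A = (\<chi> j. if j \<in> A then 1 else 0)"

definition active_cols :: "real ^ 'm ^ 'n \<Rightarrow> real ^ 'm \<Rightarrow> 'm set \<Rightarrow> real ^ 'm ^ 'n" where
  "active_cols X s A = (\<chi> i j. if j \<in> A then s $ j * X $ i $ j else 0)"

definition active_gram :: "real ^ 'm ^ 'n \<Rightarrow> real ^ 'm \<Rightarrow> 'm set \<Rightarrow> real ^ 'm ^ 'm" where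
  "active_gram X s A = transpose (active_cols X s A) ** active_cols X s A"

text \<open>
  The zero-padded Gram matrix is singular unless \<open>A = UNIV\<close>. Adding the identity on the
  complement of \<open>A\<close> gives the block diagonal matrix with blocks \<open>G\<^sub>A\<close> and \<open>I\<close>, whose inverse has
  blocks \<open>G\<^sub>A\<^sup>-\<^sup>1\<close> and \<open>I\<close>; the second block is then cut off again.
\<close>

definition active_gram_inv :: "real ^ 'm ^ 'n \<Rightarrow> real ^ 'm \<Rightarrow> 'm set \<Rightarrow> real ^ 'm ^ 'm" where
  "active_gram_inv X s A =
     (let D = (\<chi> i j. if i = j \<and> i \<notin> A then 1 else 0)
      in matrix_inv (active_gram X s A + D) - D)"

definition equi_const :: "real ^ 'm ^ 'n \<Rightarrow> real ^ 'm \<Rightarrow> 'm set \<Rightarrow> real" where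
  "equi_const X s A = (ones_on A \<bullet> (active_gram_inv X s A *v ones_on A)) powr (- 1 / 2)"

definition equi_weights :: "real ^ 'm ^ 'n \<Rightarrow> real ^ 'm \<Rightarrow> 'm set \<Rightarrow> real ^ 'm" where
  "equi_weights X s A = equi_const X s A *\<^sub>R (active_gram_inv X s A *v ones_on A)"

definition equi_vec :: "real ^ 'm ^ 'n \<Rightarrow> real ^ 'm \<Rightarrow> 'm set \<Rightarrow> real ^ 'n" where
  "equi_vec X s A = active_cols X s A *v equi_weights X s A"


text \<open>A state of the algorithm is a pair of a coefficient vector and an active set.\<close>

type_synonym 'm lars_state = "(real ^ 'm) \<times> 'm set"

definition signs :: "real ^ 'm ^ 'n \<Rightarrow> real ^ 'n \<Rightarrow> real ^ 'm \<Rightarrow> real ^ 'm" where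
  "signs X y \<beta> = (\<chi> j. sgn (corr X y \<beta> $ j))"

definition lars_dir :: "real ^ 'm ^ 'n \<Rightarrow> real ^ 'n \<Rightarrow> 'm lars_state \<Rightarrow> real ^ 'm" where
  "lars_dir X y = (\<lambda>(\<beta>, A).
     \<chi> j. if j \<in> A then signs X y \<beta> $ j * equi_weights X (signs X y \<beta>) A $ j else 0)"

text \<open>
  The positive ones among the two quotients of an index \<open>j\<close>. As \<open>x / 0 = 0\<close>, positivity also
  discards quotients with zero denominator.
\<close>

definition join_quotients ::
    "real ^ 'm ^ 'n \<Rightarrow> real ^ 'n \<Rightarrow> 'm lars_state \<Rightarrow> 'm \<Rightarrow> real set" where
  "join_quotients X y = (\<lambda>(\<beta>, A) j.
     let C = max_corr X y \<beta>; c = corr X y \<beta>;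
         K = equi_const X (signs X y \<beta>) A;
         a = transpose X *v equi_vec X (signs X y \<beta>) A
     in {q \<in> {(C - c $ j) / (K - a $ j), (C + c $ j) / (K + a $ j)}. q > 0})"

text \<open>Minima are taken in the extended reals, so that a minimum over no candidates is \<open>\<infinity>\<close>.\<close>

definition gamma_hat :: "real ^ 'm ^ 'n \<Rightarrow> real ^ 'n \<Rightarrow> 'm lars_state \<Rightarrow> ereal" where
  "gamma_hat X y = (\<lambda>(\<beta>, A).
     if A = UNIV then ereal (max_corr X y \<beta> / equi_const X (signs X y \<beta>) A)
     else Inf (ereal ` (\<Union>j\<in>-A. join_quotients X y (\<beta>, A) j)))"

definition drop_candidates ::
    "real ^ 'm ^ 'n \<Rightarrow> real ^ 'n \<Rightarrow> 'm lars_state \<Rightarrow> 'm set" where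
  "drop_candidates X y = (\<lambda>(\<beta>, A).
     {j \<in> A. lars_dir X y (\<beta>, A) $ j \<noteq> 0 \<and> - \<beta> $ j / lars_dir X y (\<beta>, A) $ j > 0})"

definition gamma_tilde :: "real ^ 'm ^ 'n \<Rightarrow> real ^ 'n \<Rightarrow> 'm lars_state \<Rightarrow> ereal" where
  "gamma_tilde X y = (\<lambda>(\<beta>, A).
     Inf ((\<lambda>j. ereal (- \<beta> $ j / lars_dir X y (\<beta>, A) $ j)) ` drop_candidates X y (\<beta>, A)))"

definition attains_hat :: "real ^ 'm ^ 'n \<Rightarrow> real ^ 'n \<Rightarrow> 'm lars_state \<Rightarrow> 'm \<Rightarrow> bool" where
  "attains_hat X y = (\<lambda>(\<beta>, A) j.
     j \<notin> A \<and> gamma_hat X y (\<beta>, A) \<in> ereal ` join_quotients X y (\<beta>, A) j)"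

definition attains_tilde :: "real ^ 'm ^ 'n \<Rightarrow> real ^ 'n \<Rightarrow> 'm lars_state \<Rightarrow> 'm \<Rightarrow> bool" where
  "attains_tilde X y = (\<lambda>(\<beta>, A) j.
     j \<in> drop_candidates X y (\<beta>, A) \<and>
     gamma_tilde X y (\<beta>, A) = ereal (- \<beta> $ j / lars_dir X y (\<beta>, A) $ j))"

definition lars_segment ::
    "real ^ 'm ^ 'n \<Rightarrow> real ^ 'n \<Rightarrow> 'm lars_state \<Rightarrow> (real ^ 'm) set" where
  "lars_segment X y S =
     {fst S + \<gamma> *\<^sub>R lars_dir X y S |\<gamma>.
        0 \<le> \<gamma> \<and> ereal \<gamma> \<le> min (gamma_hat X y S) (gamma_tilde X y S)}"

definition lars_endpoint ::
    "real ^ 'm ^ 'n \<Rightarrow> real ^ 'n \<Rightarrow> 'm lars_state \<Rightarrow> real ^ 'm" where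
  "lars_endpoint X y S =
     fst S + real_of_ereal (min (gamma_hat X y S) (gamma_tilde X y S)) *\<^sub>R lars_dir X y S"

text \<open>
  A relation, since the joining or leaving index is arbitrary when there are ties. In the rule
  \<open>full\<close> there is no index left to join; the step ends at correlation zero.
\<close>

inductive lars_step ::
    "real ^ 'm ^ 'n \<Rightarrow> real ^ 'n \<Rightarrow> 'm lars_state \<Rightarrow> 'm lars_state \<Rightarrow> bool"
  for X :: "real ^ 'm ^ 'n" and y :: "real ^ 'n" where
  leave: "max_corr X y \<beta> > 0 \<Longrightarrow> gamma_tilde X y (\<beta>, A) < gamma_hat X y (\<beta>, A) \<Longrightarrow>
     attains_tilde X y (\<beta>, A) j \<Longrightarrow>
     lars_step X y (\<beta>, A) (lars_endpoint X y (\<beta>, A), A - {j})"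
| join: "max_corr X y \<beta> > 0 \<Longrightarrow> gamma_hat X y (\<beta>, A) \<le> gamma_tilde X y (\<beta>, A) \<Longrightarrow>
     attains_hat X y (\<beta>, A) j \<Longrightarrow>
     lars_step X y (\<beta>, A) (lars_endpoint X y (\<beta>, A), insert j A)"
| full: "max_corr X y \<beta> > 0 \<Longrightarrow> gamma_hat X y (\<beta>, UNIV) \<le> gamma_tilde X y (\<beta>, UNIV) \<Longrightarrow>
     lars_step X y (\<beta>, UNIV) (lars_endpoint X y (\<beta>, UNIV), UNIV)"

definition lars_init :: "real ^ 'm ^ 'n \<Rightarrow> real ^ 'n \<Rightarrow> 'm lars_state" where
  "lars_init X y = (0, {j. \<bar>corr X y 0 $ j\<bar> = max_corr X y 0})"

definition lars_reachable :: "real ^ 'm ^ 'n \<Rightarrow> real ^ 'n \<Rightarrow> 'm lars_state \<Rightarrow> bool" where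
  "lars_reachable X y S \<longleftrightarrow> (lars_step X y)\<^sup>*\<^sup>* (lars_init X y) S"

text \<open>The starting point \<open>0\<close> is listed separately because there may be no step at all.\<close>

definition lars_trace :: "real ^ 'm ^ 'n \<Rightarrow> real ^ 'n \<Rightarrow> (real ^ 'm) set" where
  "lars_trace X y =
     {0} \<union> (\<Union>S\<in>{S. lars_reachable X y S \<and> max_corr X y (fst S) > 0}. lars_segment X y S)"

text \<open>
  Ties are allowed in the last step, i.e. when the correlation vanishes at its endpoint: then all
  inactive indices may attain the minimum, and the algorithm stops anyway.
\<close>

definition one_at_a_time :: "real ^ 'm ^ 'n \<Rightarrow> real ^ 'n \<Rightarrow> bool" where
  "one_at_a_time X y \<longleftrightarrow>
     (max_corr X y 0 > 0 \<longrightarrow> is_singleton (snd (lars_init X y))) \<and>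
     (\<forall>S. lars_reachable X y S \<and> max_corr X y (fst S) > 0 \<and> max_corr X y (lars_endpoint X y S) > 0 \<longrightarrow>
        gamma_tilde X y S \<noteq> gamma_hat X y S \<and>
        (gamma_tilde X y S < gamma_hat X y S \<longrightarrow> (\<exists>!j. attains_tilde X y S j)) \<and>
        (gamma_hat X y S < gamma_tilde X y S \<longrightarrow> (\<exists>!j. attains_hat X y S j)))"

end

theory Submission
  imports Defs
begin

text \<open>
  Convexity characterises Lasso solutions by the Karush-Kuhn-Tucker condition: \<open>\<beta>\<close> solves the
  problem with bound \<open>t = \<parallel>\<beta>\<parallel>\<^sub>1\<close> as soon as every nonzero coefficient has correlation \<open>\<plusminus>C\<close> of its
  own sign, where \<open>C\<close> is the maximal absolute correlation, and injectivity of \<open>X\<close> makes this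
  solution unique (\<open>kkt_imp_lasso_solution_iff\<close>). The theorem therefore reduces to two claims:
  every point of the trace satisfies the condition, and the trace ends with correlation zero.
  The \<open>\<ell>\<^sub>1\<close> norm is continuous along the trace, so it takes every value between \<open>0\<close> and its value
  at the end; the end point is the least squares solution and serves all larger bounds.

  The first claim is an invariant of the states of the algorithm (\<open>lars_invariant\<close>). Along the
  equiangular direction the active correlations shrink in modulus at one common rate, so only
  inequalities need care: the step length stops at the first moment where an inactive correlation
  would become too large or a coefficient would change sign. What could fail is the very
  beginning of a step. A variable that has just joined has coefficient zero and must start with
  the sign of its correlation; a variable that has just left still has maximal correlation, and
  this must now fall faster than the active ones. Both follow from one identity
  (\<open>equi_dir_insert\<close>) that compares the equiangular directions of \<open>A\<close> and of \<open>A\<close> with one more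
  index. This is where the one-at-a-time condition enters: the identity controls a change of the
  active set by a single index.

  The second claim holds because the pair of an active set \<open>A\<close> and the signs on \<open>A\<close> determines the
  line on which the coefficients move, parametrised by the maximal correlation. Beyond the end of
  a step this line violates the condition, so no pair can occur in two different steps
  (\<open>no_return\<close>); as there are finitely many pairs, the run is finite.
\<close>

section \<open>Optimality\<close>

definition l1_norm :: "real ^ 'm \<Rightarrow> real" where
  "l1_norm b = (\<Sum>j\<in>UNIV. \<bar>b $ j\<bar>)"

definition kkt :: "real ^ 'm ^ 'n \<Rightarrow> real ^ 'n \<Rightarrow> real ^ 'm \<Rightarrow> bool" where
  "kkt X y \<beta> \<longleftrightarrow> (\<forall>j. \<beta> $ j * corr X y \<beta> $ j = max_corr X y \<beta> * \<bar>\<beta> $ j\<bar>)"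

definition gram_mult :: "real ^ 'm ^ 'n \<Rightarrow> real ^ 'm \<Rightarrow> real ^ 'm" where
  "gram_mult X b = transpose X *v (X *v b)"

lemma gram_mult_diff: "gram_mult X (b - b') = gram_mult X b - gram_mult X b'"
  by (simp add: gram_mult_def matrix_vector_mult_diff_distrib del: transpose_matrix_vector)

lemma gram_mult_scaleR: "gram_mult X (r *\<^sub>R b) = r *\<^sub>R gram_mult X b"
  by (simp add: gram_mult_def matrix_vector_mult_scaleR del: transpose_matrix_vector)

lemma gram_mult_zero: "gram_mult X 0 = 0"
  by (simp add: gram_mult_def del: transpose_matrix_vector)

lemma corr_le_max_corr: "\<bar>corr X y \<beta> $ j\<bar> \<le> max_corr X y \<beta>"
  unfolding max_corr_def by (rule Max_ge) auto

lemma max_corr_nonneg: "0 \<le> max_corr X y \<beta>"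
  using corr_le_max_corr[of X y \<beta> undefined] by linarith

lemma max_corr_eqI:
  assumes "\<And>j. \<bar>corr X y \<beta> $ j\<bar> \<le> C" "\<bar>corr X y \<beta> $ k\<bar> = C"
  shows "max_corr X y \<beta> = C"
  unfolding max_corr_def by (rule Max_eqI) (use assms in auto)

lemma corr_add: "corr X y (\<beta> + b) = corr X y \<beta> - gram_mult X b"
  unfolding corr_def gram_mult_def
  by (simp add: matrix_vector_mult_diff_distrib matrix_vector_right_distrib
    del: transpose_matrix_vector)

lemma inner_gram_mult: "b \<bullet> gram_mult X b = (norm (X *v b))\<^sup>2"
  by (simp only: gram_mult_def power2_norm_eq_inner transpose_matrix_vector dot_lmul_matrix
    inner_commute[of b])

lemma residual_add:
  "(norm (y - X *v (\<beta> + b)))\<^sup>2 = (norm (y - X *v \<beta>))\<^sup>2 - 2 * (corr X y \<beta> \<bullet> b) + (norm (X *v b))\<^sup>2"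
proof -
  have 1: "corr X y \<beta> \<bullet> b = (y - X *v \<beta>) \<bullet> (X *v b)"
    by (simp only: corr_def transpose_matrix_vector dot_lmul_matrix)
  have 2: "y - X *v (\<beta> + b) = (y - X *v \<beta>) - X *v b"
    by (simp add: matrix_vector_right_distrib)
  show ?thesis
    unfolding 1 2 power2_norm_eq_inner by (simp add: inner_diff_left inner_diff_right inner_commute)
qed

lemma kkt_inner: "kkt X y \<beta> \<Longrightarrow> corr X y \<beta> \<bullet> \<beta> = max_corr X y \<beta> * l1_norm \<beta>"
  unfolding kkt_def l1_norm_def inner_vec_def by (simp add: sum_distrib_left mult.commute)

lemma corr_inner_le: "corr X y \<beta> \<bullet> b \<le> max_corr X y \<beta> * l1_norm b"
proof -
  have "corr X y \<beta> $ j * b $ j \<le> max_corr X y \<beta> * \<bar>b $ j\<bar>" for j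
    using mult_right_mono[OF corr_le_max_corr[of X y \<beta> j], of "\<bar>b $ j\<bar>"]
      abs_ge_self[of "corr X y \<beta> $ j * b $ j"] by (simp add: abs_mult)
  then show ?thesis
    unfolding l1_norm_def inner_vec_def by (simp add: sum_distrib_left sum_mono)
qed

locale full_rank_design =
  fixes X :: "real ^ 'm ^ 'n" and y :: "real ^ 'n"
  assumes full_rank: "X *v b = 0 \<Longrightarrow> b = 0"
begin

text \<open>
  Expanding the square, \<open>b\<close> is worse than \<open>\<beta>\<close> by at least the square of the distance between the
  two predictions, because the linear term is at most \<open>C (\<parallel>b\<parallel>\<^sub>1 - \<parallel>\<beta>\<parallel>\<^sub>1)\<close>. This needs the bound to be
  attained, or the residual to be orthogonal to all columns.
\<close>

lemma kkt_imp_lasso_solution_iff: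
  assumes "kkt X y \<beta>" and "l1_norm \<beta> \<le> t"
    and tight: "max_corr X y \<beta> = 0 \<or> l1_norm \<beta> = t"
  shows "lasso_solution X y t b \<longleftrightarrow> b = \<beta>"
proof -
  have le: "(norm (y - X *v \<beta>))\<^sup>2 + (norm (X *v (b - \<beta>)))\<^sup>2 \<le> (norm (y - X *v b))\<^sup>2"
    if "l1_norm b \<le> t" for b
  proof -
    have "corr X y \<beta> \<bullet> (b - \<beta>) \<le> max_corr X y \<beta> * l1_norm b - max_corr X y \<beta> * l1_norm \<beta>"
      using corr_inner_le[of X y \<beta> b] kkt_inner[OF assms(1)] by (simp add: inner_diff_right)
    also have "\<dots> \<le> 0"
      using tight mult_left_mono[OF that max_corr_nonneg[of X y \<beta>]] by auto
    finally show ?thesis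
      using residual_add[of y X \<beta> "b - \<beta>"] by simp
  qed
  have "b = \<beta>" if "l1_norm b \<le> t" "(norm (y - X *v b))\<^sup>2 \<le> (norm (y - X *v \<beta>))\<^sup>2" for b
  proof -
    have "(norm (X *v (b - \<beta>)))\<^sup>2 \<le> 0"
      using le[OF that(1)] that(2) by linarith
    then show ?thesis
      using full_rank[of "b - \<beta>"] by simp
  qed
  moreover have "(norm (y - X *v \<beta>))\<^sup>2 \<le> (norm (y - X *v b))\<^sup>2" if "l1_norm b \<le> t" for b
    using le[OF that] zero_le_power2[of "norm (X *v (b - \<beta>))"] by linarith
  ultimately show ?thesis
    using assms(2) unfolding lasso_solution_def is_arg_min_linorder l1_norm_def[symmetric]
    by blast
qed

text \<open>
  The Gram matrix of the columns in \<open>A\<close> is nonsingular; it is used as a uniqueness principle for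
  vectors supported on \<open>A\<close>.
\<close>

lemma gram_block_nonsingular:
  assumes "\<And>j. j \<notin> A \<Longrightarrow> b $ j = 0" and "\<And>j. j \<in> A \<Longrightarrow> gram_mult X b $ j = 0"
  shows "b = 0"
proof -
  have "b \<bullet> gram_mult X b = 0"
    unfolding inner_vec_def
  proof (intro sum.neutral ballI)
    show "b $ j \<bullet> gram_mult X b $ j = 0" for j
      using assms[of j] by (cases "j \<in> A") auto
  qed
  then show ?thesis
    using full_rank by (simp add: inner_gram_mult)
qed

end

section \<open>Equiangular directions\<close>

text \<open>
  The solution, supported on \<open>A\<close>, of the equations \<open>x\<^sub>j \<bullet> X p = s\<^sub>j\<close> for \<open>j \<in> A\<close>: the direction in
  coefficient space before normalisation. If \<open>s\<close> are the signs of the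
  correlations, moving by \<open>\<tau> p\<close> lowers the modulus of the active ones by \<open>\<tau>\<close>, as long as they do
  not change sign.
\<close>

definition equi_dir :: "real ^ 'm ^ 'n \<Rightarrow> real ^ 'm \<Rightarrow> 'm set \<Rightarrow> real ^ 'm" where
  "equi_dir X s A = (\<chi> j. if j \<in> A then s $ j * (active_gram_inv X s A *v ones_on A) $ j else 0)"

lemma equi_dir_inactive: "j \<notin> A \<Longrightarrow> equi_dir X s A $ j = 0"
  by (simp add: equi_dir_def)

lemma active_cols_mult:
  "active_cols X s A *v b = X *v (\<chi> j. if j \<in> A then s $ j * b $ j else 0)"
  unfolding active_cols_def matrix_vector_mult_def
  by (auto simp: vec_eq_iff intro!: sum.cong)

lemma transpose_active_cols_mult:
  "(transpose (active_cols X s A) *v v) $ j = (if j \<in> A then s $ j * (transpose X *v v) $ j else 0)"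
  unfolding active_cols_def matrix_vector_mult_def transpose_def
  by (auto simp: sum_distrib_left mult.assoc)

lemma active_cols_equi_dir:
  "active_cols X s A *v (active_gram_inv X s A *v ones_on A) = X *v equi_dir X s A"
  by (simp add: active_cols_mult equi_dir_def)

lemma equi_vec_eq: "equi_vec X s A = equi_const X s A *\<^sub>R (X *v equi_dir X s A)"
  unfolding equi_vec_def equi_weights_def
  by (simp add: matrix_vector_mult_scaleR active_cols_equi_dir)

lemma lars_dir_eq:
  "lars_dir X y (\<beta>, A) =
    equi_const X (signs X y \<beta>) A *\<^sub>R equi_dir X (signs X y \<beta>) A"
  unfolding lars_dir_def equi_weights_def equi_dir_def by (auto simp: vec_eq_iff)

context full_rank_design
begin

lemma active_gram_mult:
  "(active_gram X s A *v b) $ j =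
    (if j \<in> A then s $ j * gram_mult X (\<chi> j. if j \<in> A then s $ j * b $ j else 0) $ j else 0)"
  by (simp only: active_gram_def gram_mult_def matrix_vector_mul_assoc[symmetric] active_cols_mult
    transpose_active_cols_mult)

text \<open>
  The block diagonal matrix \<open>M\<close> with blocks \<open>G\<^sub>A\<close> and \<open>I\<close> is nonsingular, and the correction \<open>D\<close>
  vanishes on vectors supported on \<open>A\<close>, so that inverting \<open>M\<close> inverts \<open>G\<^sub>A\<close>.
\<close>

lemma active_gram_inv_ones:
  assumes signs: "\<And>j. j \<in> A \<Longrightarrow> s $ j * s $ j = 1"
  shows "active_gram X s A *v (active_gram_inv X s A *v ones_on A) = ones_on A"
    and "j \<notin> A \<Longrightarrow> (active_gram_inv X s A *v ones_on A) $ j = 0"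
proof -
  define D :: "real ^ 'm ^ 'm" where "D = (\<chi> i j. if i = j \<and> i \<notin> A then 1 else 0)"
  define M where "M = active_gram X s A + D"
  define h where "h = matrix_inv M *v ones_on A"
  have D: "(D *v b) $ j = (if j \<in> A then 0 else b $ j)" for b j
    unfolding D_def matrix_vector_mult_def by (simp add: if_distrib if_distribR sum.If_cases cong: if_cong)
  have M: "M *v b = active_gram X s A *v b + D *v b" for b
    by (simp add: M_def matrix_vector_mult_add_rdistrib)
  have "b = 0" if "M *v b = 0" for b
  proof -
    let ?b = "\<chi> j. if j \<in> A then s $ j * b $ j else 0"
    have Mb: "(active_gram X s A *v b) $ j + (D *v b) $ j = 0" for j
      using that unfolding M by (metis vector_add_component zero_index)
    have off: "b $ j = 0" if "j \<notin> A" for j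
      using Mb[of j] that by (simp add: D active_gram_mult)
    have "?b = 0"
    proof (rule gram_block_nonsingular[of A])
      fix j assume "j \<in> A"
      then have "s $ j * gram_mult X ?b $ j = 0" "s $ j \<noteq> 0"
        using Mb[of j] signs[of j] by (auto simp: D active_gram_mult)
      then show "gram_mult X ?b $ j = 0" by simp
    qed simp
    then have "s $ j * b $ j = 0" if "j \<in> A" for j
      using that by (simp add: vec_eq_iff) (metis mult_eq_0_iff)
    then show ?thesis
      using off signs by (simp add: vec_eq_iff) (metis mult_eq_0_iff zero_neq_one)
  qed
  then have "invertible M"
    by (metis invertible_left_inverse matrix_left_invertible_ker)
  then have "M ** matrix_inv M = mat 1"
    unfolding matrix_inv_def invertible_def by (metis (mono_tags, lifting) someI_ex)
  then have Mh: "active_gram X s A *v h + D *v h = ones_on A"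
    using M[of h] by (simp add: h_def matrix_vector_mul_assoc)
  have off: "h $ j = 0" if "j \<notin> A" for j
    using arg_cong[OF Mh, of "\<lambda>v. v $ j"] that by (simp add: D active_gram_mult ones_on_def)
  have "D *v h = 0" "D *v ones_on A = 0"
    using off by (auto simp: vec_eq_iff D ones_on_def)
  moreover have "active_gram_inv X s A = matrix_inv M - D"
    by (simp add: active_gram_inv_def Let_def M_def D_def)
  ultimately have h: "active_gram_inv X s A *v ones_on A = h"
    by (simp add: h_def matrix_vector_mult_diff_rdistrib)
  show "active_gram X s A *v (active_gram_inv X s A *v ones_on A) = ones_on A"
    using Mh \<open>D *v h = 0\<close> by (simp add: h)
  show "j \<notin> A \<Longrightarrow> (active_gram_inv X s A *v ones_on A) $ j = 0"
    using off by (simp add: h)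
qed

lemma gram_mult_equi_dir:
  assumes signs: "\<And>j. j \<in> A \<Longrightarrow> s $ j * s $ j = 1" and "j \<in> A"
  shows "gram_mult X (equi_dir X s A) $ j = s $ j"
proof -
  have "s $ j * gram_mult X (equi_dir X s A) $ j = 1"
    using arg_cong[OF active_gram_inv_ones(1)[of A s, OF signs], of "\<lambda>v. v $ j"] \<open>j \<in> A\<close>
    unfolding active_gram_mult equi_dir_def[symmetric] by (simp add: ones_on_def)
  then have "(s $ j * s $ j) * gram_mult X (equi_dir X s A) $ j = s $ j"
    by (metis mult.assoc mult.right_neutral)
  then show ?thesis
    using signs[OF \<open>j \<in> A\<close>] by simp
qed

text \<open>
  The quadratic form under the root is the squared length of \<open>X p\<close>, which cannot vanish since
  \<open>X p\<close> has inner product \<open>\<plusminus>1\<close> with the active columns.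
\<close>

lemma equi_const_pos:
  assumes signs: "\<And>j. j \<in> A \<Longrightarrow> s $ j * s $ j = 1" and "A \<noteq> {}"
  shows "0 < equi_const X s A"
proof -
  let ?g = "active_gram_inv X s A *v ones_on A"
  have "ones_on A \<bullet> ?g = ?g \<bullet> (active_gram X s A *v ?g)"
    using active_gram_inv_ones(1)[of A s] signs by (simp add: inner_commute)
  also have "\<dots> = (norm (X *v equi_dir X s A))\<^sup>2"
    unfolding active_gram_def matrix_vector_mul_assoc[symmetric] active_cols_equi_dir[symmetric]
    by (simp only: inner_gram_mult[unfolded gram_mult_def])
  finally have "ones_on A \<bullet> ?g = (norm (X *v equi_dir X s A))\<^sup>2" .
  moreover obtain j where "j \<in> A" using \<open>A \<noteq> {}\<close> by blast
  then have "X *v equi_dir X s A \<noteq> 0"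
    using gram_mult_equi_dir[of A s j] signs[of j] signs
    by (force simp: gram_mult_def simp del: transpose_matrix_vector)
  ultimately show ?thesis
    unfolding equi_const_def by simp
qed

text \<open>
  The difference \<open>q\<close> of the two directions is supported on \<open>insert j A\<close>, and \<open>X q\<close> is orthogonal to
  the columns in \<open>A\<close>. Hence only the index \<open>j\<close> contributes to \<open>\<parallel>X q\<parallel>\<^sup>2 = \<Sum>\<^sub>i q\<^sub>i (x\<^sub>i \<bullet> X q)\<close>. As the left
  side is positive unless the directions agree, the two factors on the right have the same sign.
\<close>

lemma equi_dir_insert:
  assumes signs: "\<And>i. i \<in> insert j A \<Longrightarrow> s' $ i * s' $ i = 1"
    and agree: "\<And>i. i \<in> A \<Longrightarrow> s $ i = s' $ i" and "j \<notin> A"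
  shows "(norm (X *v (equi_dir X s' (insert j A) - equi_dir X s A)))\<^sup>2 =
    (s' $ j * equi_dir X s' (insert j A) $ j) * (1 - s' $ j * gram_mult X (equi_dir X s A) $ j)"
proof -
  let ?p = "equi_dir X s A" and ?p' = "equi_dir X s' (insert j A)"
  have p: "gram_mult X ?p $ i = s' $ i" if "i \<in> A" for i
    using gram_mult_equi_dir[of A s i] that signs agree by simp
  have p': "gram_mult X ?p' $ i = s' $ i" if "i \<in> insert j A" for i
    using gram_mult_equi_dir[of "insert j A" s' i] that signs by blast
  have diff: "gram_mult X (?p' - ?p) $ i = gram_mult X ?p' $ i - gram_mult X ?p $ i" for i
    by (simp add: gram_mult_diff)
  have "(norm (X *v (?p' - ?p)))\<^sup>2 = (\<Sum>i\<in>UNIV. (?p' - ?p) $ i * gram_mult X (?p' - ?p) $ i)"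
    unfolding inner_gram_mult[symmetric] inner_vec_def by simp
  also have "\<dots> = (\<Sum>i\<in>{j}. (?p' - ?p) $ i * gram_mult X (?p' - ?p) $ i)"
  proof (rule sum.mono_neutral_right)
    show "\<forall>i\<in>UNIV - {j}. (?p' - ?p) $ i * gram_mult X (?p' - ?p) $ i = 0"
    proof
      fix i assume "i \<in> UNIV - {j}"
      then show "(?p' - ?p) $ i * gram_mult X (?p' - ?p) $ i = 0"
        using p[of i] p'[of i] by (cases "i \<in> A") (auto simp: diff equi_dir_inactive)
    qed
  qed auto
  also have "\<dots> = ?p' $ j * (s' $ j - gram_mult X ?p $ j)"
    using p'[of j] \<open>j \<notin> A\<close> by (simp add: diff equi_dir_inactive del: vector_minus_component)
      (simp add: equi_dir_inactive)
  also have "\<dots> = (s' $ j * s' $ j) * (?p' $ j * (s' $ j - gram_mult X ?p $ j))"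
    using signs[of j] by simp
  also have "\<dots> = (s' $ j * ?p' $ j) * (s' $ j * s' $ j - s' $ j * gram_mult X ?p $ j)"
    by (simp only: algebra_simps)
  finally show ?thesis
    using signs[of j] by simp
qed

text \<open>
  A correlation that catches up with the maximal level from below does not fall as fast as that
  level, which is the last premise; the new coefficient then starts with the sign of its
  correlation. With \<open>A = {}\<close> this covers the first step, where the direction of the empty set is
  zero.
\<close>

lemma entering_direction_pos:
  assumes signs: "\<And>i. i \<in> insert j A \<Longrightarrow> s' $ i * s' $ i = 1"
    and agree: "\<And>i. i \<in> A \<Longrightarrow> s $ i = s' $ i" and "j \<notin> A"
    and lt: "s' $ j * gram_mult X (equi_dir X s A) $ j < 1"
  shows "0 < s' $ j * equi_dir X s' (insert j A) $ j"
proof -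
  have "equi_dir X s' (insert j A) \<noteq> equi_dir X s A"
    using gram_mult_equi_dir[of "insert j A" s' j] signs lt signs[of j] by auto
  then have "0 < (norm (X *v (equi_dir X s' (insert j A) - equi_dir X s A)))\<^sup>2"
    using full_rank[of "equi_dir X s' (insert j A) - equi_dir X s A"] by auto
  also have "\<dots> = (s' $ j * equi_dir X s' (insert j A) $ j) *
      (1 - s' $ j * gram_mult X (equi_dir X s A) $ j)"
    by (rule equi_dir_insert) (use assms in auto)
  finally show ?thesis
    using lt by (auto simp: zero_less_mult_iff[of "_ * _" "_ - _"])
qed

text \<open>
  A coefficient that runs into zero has direction opposite to its sign. Once it is dropped, its
  correlation leaves the maximal level downwards.
\<close>

lemma leaving_correlation_falls:
  assumes signs: "\<And>i. i \<in> insert j A \<Longrightarrow> s' $ i * s' $ i = 1"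
    and agree: "\<And>i. i \<in> A \<Longrightarrow> s $ i = s' $ i" and "j \<notin> A"
    and neg: "s' $ j * equi_dir X s' (insert j A) $ j < 0"
  shows "1 < s' $ j * gram_mult X (equi_dir X s A) $ j"
proof -
  have "equi_dir X s' (insert j A) \<noteq> equi_dir X s A"
    using neg equi_dir_inactive[OF \<open>j \<notin> A\<close>, of X s] by auto
  then have "0 < (norm (X *v (equi_dir X s' (insert j A) - equi_dir X s A)))\<^sup>2"
    using full_rank[of "equi_dir X s' (insert j A) - equi_dir X s A"] by auto
  also have "\<dots> = (s' $ j * equi_dir X s' (insert j A) $ j) *
      (1 - s' $ j * gram_mult X (equi_dir X s A) $ j)"
    by (rule equi_dir_insert) (use assms in auto)
  finally show ?thesis
    using neg by (auto simp: zero_less_mult_iff[of "_ * _" "_ - _"])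
qed

end

section \<open>Steps of the algorithm preserve optimality\<close>

text \<open>
  The first assumptions say that \<open>\<beta>\<close> satisfies the optimality condition with active set \<open>A\<close>. The
  set \<open>A\<close> need not contain all indices of maximal correlation, nor need the coefficients on \<open>A\<close> be
  nonzero; the exceptions are the index dropped or added last. The assumptions \<open>enter\<close> and \<open>exit\<close>
  state that these exceptional indices move in the right direction in the next step, so that the
  optimality condition is not violated immediately.
\<close>

locale lars_invariant = full_rank_design X y for X :: "real ^ 'm ^ 'n" and y +
  fixes \<beta> :: "real ^ 'm" and A :: "'m set"
  assumes max_corr_pos: "0 < max_corr X y \<beta>"
    and nonempty: "A \<noteq> {}"
    and active: "j \<in> A \<Longrightarrow> \<bar>corr X y \<beta> $ j\<bar> = max_corr X y \<beta>"
    and inactive: "j \<notin> A \<Longrightarrow> \<beta> $ j = 0"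
    and agree: "0 \<le> \<beta> $ j * signs X y \<beta> $ j"
    and enter: "j \<in> A \<Longrightarrow> \<beta> $ j = 0 \<Longrightarrow>
      0 < signs X y \<beta> $ j * equi_dir X (signs X y \<beta>) A $ j"
    and exit: "j \<notin> A \<Longrightarrow> \<bar>corr X y \<beta> $ j\<bar> = max_corr X y \<beta> \<Longrightarrow>
      1 < signs X y \<beta> $ j * gram_mult X (equi_dir X (signs X y \<beta>) A) $ j"
begin

abbreviation c where "c \<equiv> corr X y \<beta>"
abbreviation C where "C \<equiv> max_corr X y \<beta>"
abbreviation s where "s \<equiv> signs X y \<beta>"
abbreviation p where "p \<equiv> equi_dir X s A"
\<comment> \<open>The correlations decrease along the direction with velocity \<open>K h\<close>, and \<open>C\<close> with velocity \<open>K\<close>.\<close>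
abbreviation h where "h \<equiv> gram_mult X p"
abbreviation K where "K \<equiv> equi_const X s A"
abbreviation d where "d \<equiv> lars_dir X y (\<beta>, A)"
abbreviation move where "move \<gamma> \<equiv> \<beta> + \<gamma> *\<^sub>R d"

lemma signs_square: "j \<in> A \<Longrightarrow> s $ j * s $ j = 1"
  using active[of j] max_corr_pos by (auto simp: signs_def sgn_if)

lemma abs_signs: "j \<in> A \<Longrightarrow> \<bar>s $ j\<bar> = 1"
  using active[of j] max_corr_pos by (auto simp: signs_def abs_sgn_eq)

lemma corr_eq: "j \<in> A \<Longrightarrow> c $ j = C * s $ j"
  using active[of j] max_corr_pos by (auto simp: signs_def sgn_if abs_if split: if_splits)

lemma K_pos: "0 < K"
  using equi_const_pos signs_square nonempty by blast

lemma h_active: "j \<in> A \<Longrightarrow> h $ j = s $ j"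
  using gram_mult_equi_dir signs_square by blast

lemma corr_move: "corr X y (move \<gamma>) $ j = c $ j - \<gamma> * K * h $ j"
  by (simp add: corr_add lars_dir_eq gram_mult_scaleR)

lemma corr_move_active: "j \<in> A \<Longrightarrow> corr X y (move \<gamma>) $ j = (C - \<gamma> * K) * s $ j"
  by (simp add: corr_move h_active corr_eq algebra_simps)

lemma d_eq: "d $ j = K * p $ j"
  by (simp add: lars_dir_eq)

lemma signs_move:
  "j \<in> A \<Longrightarrow> 0 < C - \<gamma> * K \<Longrightarrow> signs X y (move \<gamma>) $ j = s $ j"
  using signs_square[of j] by (simp add: signs_def[of X y "move \<gamma>"] corr_move_active sgn_mult)
    (auto simp: signs_def)

lemma join_quotients_eq:
  "join_quotients X y (\<beta>, A) j =
    {q \<in> {(C - c $ j) / (K - K * h $ j), (C + c $ j) / (K + K * h $ j)}. 0 < q}"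
  by (simp add: join_quotients_def Let_def equi_vec_eq matrix_vector_mult_scaleR gram_mult_def
    del: transpose_matrix_vector)

lemma exit_sign:
  assumes "j \<notin> A" "\<sigma> \<in> {1, -1}" "\<sigma> * c $ j = C"
  shows "1 < \<sigma> * h $ j"
proof -
  have "\<bar>c $ j\<bar> = C" "s $ j = \<sigma>"
    using assms max_corr_pos by (auto simp: signs_def sgn_if)
  then show ?thesis using exit[of j] assms by simp
qed

text \<open>
  The quotients are the positive times at which an inactive correlation reaches the maximal level
  with one of the two signs. The velocities are never equal at such a time: equality would force
  the correlation to be maximal from the start, which \<open>exit\<close> excludes.
\<close>

lemma join_quotients_iff:
  assumes "j \<notin> A"
  shows "q \<in> join_quotients X y (\<beta>, A) j \<longleftrightarrow>
    0 < q \<and> (\<exists>\<sigma>\<in>{1, -1}. \<sigma> * corr X y (move q) $ j = C - q * K)" (is "?L \<longleftrightarrow> ?R")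
proof -
  have one: "q = (C - \<sigma> * c $ j) / (K - K * (\<sigma> * h $ j)) \<longleftrightarrow> \<sigma> * corr X y (move q) $ j = C - q * K"
    if "\<sigma> \<in> {1, -1}" "0 < q" for \<sigma>
  proof (cases "\<sigma> * h $ j = 1")
    case True
    have "\<sigma> * c $ j - q * K = C - q * K \<longleftrightarrow> \<sigma> * c $ j = C" by auto
    moreover have "\<sigma> * corr X y (move q) $ j = \<sigma> * c $ j - q * K * (\<sigma> * h $ j)"
      by (simp add: corr_move algebra_simps)
    ultimately show ?thesis
      using True exit_sign[OF assms that(1)] that(2) by auto
  next
    case False
    then have "K - K * (\<sigma> * h $ j) \<noteq> 0"
      using K_pos by simp
    then have "q = (C - \<sigma> * c $ j) / (K - K * (\<sigma> * h $ j)) \<longleftrightarrow>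
        q * (K - K * (\<sigma> * h $ j)) = C - \<sigma> * c $ j"
      by (simp add: nonzero_eq_divide_eq)
    also have "\<dots> \<longleftrightarrow> \<sigma> * corr X y (move q) $ j = C - q * K"
      by (auto simp: corr_move algebra_simps)
    finally show ?thesis .
  qed
  show ?thesis
    using one[of 1] one[of "-1"] by (auto simp: join_quotients_eq)
qed

text \<open>
  The correlation crosses the maximal level from below, so that beyond this time it strictly exceeds the
  maximal level.
\<close>

lemma join_crossing:
  assumes "j \<notin> A" "0 < q" "\<sigma> \<in> {1, -1}" "\<sigma> * corr X y (move q) $ j = C - q * K"
  shows "\<sigma> * h $ j < 1"
proof (rule ccontr)
  assume n: "\<not> \<sigma> * h $ j < 1"
  have eq: "C - \<sigma> * c $ j = q * K * (1 - \<sigma> * h $ j)"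
    using assms(4) by (simp add: corr_move algebra_simps)
  have "\<sigma> * c $ j \<le> C"
    using assms(3) corr_le_max_corr[of X y \<beta> j] by auto
  moreover have "q * K * (1 - \<sigma> * h $ j) \<le> 0"
    using n assms(2) K_pos by (intro mult_nonneg_nonpos) auto
  ultimately have "\<sigma> * c $ j = C" "q * K * (1 - \<sigma> * h $ j) = 0"
    using eq by linarith+
  then show False
    using exit_sign[OF assms(1,3)] assms(2) K_pos by auto
qed

lemma no_early_join:
  assumes "j \<notin> A" "0 \<le> \<gamma>" "\<And>q. q \<in> join_quotients X y (\<beta>, A) j \<Longrightarrow> \<gamma> \<le> q"
  shows "\<bar>corr X y (move \<gamma>) $ j\<bar> \<le> C - \<gamma> * K"
proof -
  have "\<sigma> * corr X y (move \<gamma>) $ j \<le> C - \<gamma> * K" if \<sigma>: "\<sigma> \<in> {1, -1}" for \<sigma>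
  proof (rule ccontr)
    assume "\<not> ?thesis"
    then have lt: "C - \<sigma> * c $ j < \<gamma> * (K - K * (\<sigma> * h $ j))"
      by (simp add: corr_move algebra_simps)
    have le: "\<sigma> * c $ j \<le> C"
      using \<sigma> corr_le_max_corr[of X y \<beta> j] by auto
    then have den: "0 < K - K * (\<sigma> * h $ j)"
      using lt mult_nonneg_nonpos[OF assms(2), of "K - K * (\<sigma> * h $ j)"] by linarith
    then have "\<sigma> * h $ j < 1" using K_pos by simp
    then have "\<sigma> * c $ j < C"
      using le exit_sign[OF assms(1) \<sigma>] by fastforce
    then have "(C - \<sigma> * c $ j) / (K - K * (\<sigma> * h $ j)) \<in> join_quotients X y (\<beta>, A) j"
      using den \<sigma> by (auto simp: join_quotients_eq)
    then have "\<gamma> \<le> (C - \<sigma> * c $ j) / (K - K * (\<sigma> * h $ j))"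
      using assms(3) by blast
    then show False
      using lt den by (simp add: pos_le_divide_eq)
  qed
  from this[of 1] this[of "-1"] show ?thesis by auto
qed

text \<open>
  At time \<open>C / K\<close> the maximal level is zero. An inactive correlation that has not met it earlier is
  squeezed to zero there, so this time itself is a quotient.
\<close>

lemma ex_join_quotient:
  assumes "j \<notin> A"
  shows "\<exists>q\<in>join_quotients X y (\<beta>, A) j. q \<le> C / K"
proof (rule ccontr)
  assume n: "\<not> ?thesis"
  have "\<bar>corr X y (move (C / K)) $ j\<bar> \<le> C - C / K * K"
    by (rule no_early_join[OF assms]) (use n max_corr_pos K_pos in force)+
  then have "corr X y (move (C / K)) $ j = C - C / K * K"
    using K_pos by simp
  then have "C / K \<in> join_quotients X y (\<beta>, A) j"
    using max_corr_pos K_pos by (subst join_quotients_iff[OF assms]) auto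
  then show False using n by auto
qed

text \<open>
  In either case of the definition \<open>gamma_hat\<close> is finite and at most \<open>C / K\<close>, so the maximal level
  stays nonnegative throughout the step.
\<close>

lemma gamma_hat_cases:
  obtains g where "gamma_hat X y (\<beta>, A) = ereal g" "0 < g" "g \<le> C / K"
    "\<And>j q. j \<notin> A \<Longrightarrow> q \<in> join_quotients X y (\<beta>, A) j \<Longrightarrow> g \<le> q"
    "A = UNIV \<Longrightarrow> g = C / K"
    "A \<noteq> UNIV \<Longrightarrow> \<exists>j. j \<notin> A \<and> g \<in> join_quotients X y (\<beta>, A) j"
proof (cases "A = UNIV")
  case True
  show ?thesis
    by (rule that[of "C / K"]) (use True max_corr_pos K_pos in \<open>auto simp: gamma_hat_def\<close>)
next
  case False
  define Q where "Q = (\<Union>j\<in>-A. join_quotients X y (\<beta>, A) j)"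
  have fin: "finite Q" unfolding Q_def join_quotients_eq by auto
  obtain k where k: "k \<notin> A" using False by auto
  obtain q where q: "q \<in> Q" "q \<le> C / K"
    using ex_join_quotient[OF k] k unfolding Q_def by blast
  have min: "Min Q \<in> Q" "\<And>q. q \<in> Q \<Longrightarrow> Min Q \<le> q"
    using fin q by (auto intro!: Min_in)
  have "Inf (ereal ` Q) = ereal (Min Q)"
    by (rule Inf_eqI) (use min in auto)
  then have "gamma_hat X y (\<beta>, A) = ereal (Min Q)"
    using False by (simp add: gamma_hat_def Q_def)
  moreover have "0 < Min Q"
    using min(1) unfolding Q_def join_quotients_eq by auto
  moreover have "Min Q \<le> C / K"
    using min(2)[OF q(1)] q(2) by linarith
  moreover have "\<And>j q. j \<notin> A \<Longrightarrow> q \<in> join_quotients X y (\<beta>, A) j \<Longrightarrow> Min Q \<le> q"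
    using min(2) unfolding Q_def by blast
  moreover have "\<exists>j. j \<notin> A \<and> Min Q \<in> join_quotients X y (\<beta>, A) j"
    using min(1) unfolding Q_def by blast
  ultimately show ?thesis
    using False by (intro that) simp_all
qed

lemma drop_candidate_ge:
  "j \<in> drop_candidates X y (\<beta>, A) \<Longrightarrow> gamma_tilde X y (\<beta>, A) \<le> ereal (- \<beta> $ j / d $ j)"
  unfolding gamma_tilde_def prod.case by (rule INF_lower)

lemma gamma_tilde_cases:
  obtains "gamma_tilde X y (\<beta>, A) = \<infinity>"
  | j where "attains_tilde X y (\<beta>, A) j"
proof (cases "drop_candidates X y (\<beta>, A) = {}")
  case True
  then show ?thesis using that(1) by (simp add: gamma_tilde_def top_ereal_def)
next
  case False
  let ?f = "\<lambda>j. ereal (- \<beta> $ j / d $ j)"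
  let ?T = "?f ` drop_candidates X y (\<beta>, A)"
  have T: "finite ?T" "?T \<noteq> {}" using False by auto
  have "Inf ?T \<in> ?T"
    using Min_in[OF T] Min_Inf[OF T] by simp
  then show ?thesis
    using that(2) by (auto simp: gamma_tilde_def attains_tilde_def)
qed

lemma gamma_tilde_pos: "0 < gamma_tilde X y (\<beta>, A)"
proof (cases rule: gamma_tilde_cases)
  case (2 j)
  then show ?thesis by (simp add: attains_tilde_def drop_candidates_def)
qed simp

text \<open>
  By \<open>enter\<close> an active coefficient that starts at zero moves away from zero, so a coefficient
  vanishing at a positive time was nonzero before and is a candidate for dropping.
\<close>

lemma drop_hit:
  assumes "j \<in> A" "0 < \<gamma>" "move \<gamma> $ j = 0"
  shows "j \<in> drop_candidates X y (\<beta>, A)" "\<gamma> = - \<beta> $ j / d $ j"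
proof -
  have ne: "d $ j \<noteq> 0"
  proof
    assume "d $ j = 0"
    then have "\<beta> $ j = 0" "p $ j = 0"
      using assms(3) K_pos by (auto simp: d_eq)
    then show False using enter[OF assms(1)] by simp
  qed
  have "\<gamma> * d $ j = - \<beta> $ j"
    using assms(3) by (simp add: add_eq_0_iff)
  then show eq: "\<gamma> = - \<beta> $ j / d $ j"
    by (simp only: nonzero_eq_divide_eq[OF ne])
  show "j \<in> drop_candidates X y (\<beta>, A)"
    using ne eq assms unfolding drop_candidates_def by auto
qed

lemma drop_hit_ge:
  assumes "j \<in> A" "0 < \<gamma>" "move \<gamma> $ j = 0"
  shows "gamma_tilde X y (\<beta>, A) \<le> ereal \<gamma>"
  using drop_hit[OF assms] drop_candidate_ge by metis

lemma drop_direction: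
  assumes "j \<in> drop_candidates X y (\<beta>, A)"
  shows "s $ j * d $ j < 0"
proof -
  have j: "j \<in> A" and q: "0 < - \<beta> $ j / d $ j" "d $ j \<noteq> 0"
    using assms by (auto simp: drop_candidates_def)
  have s: "s $ j \<noteq> 0" using abs_signs[OF j] by auto
  have "\<beta> $ j \<noteq> 0" using q by auto
  then have pos: "0 < \<beta> $ j * s $ j" using s agree[of j] by (simp add: less_le)
  show ?thesis
    using q(1) pos by (auto simp: divide_less_0_iff zero_less_mult_iff mult_less_0_iff)
qed

lemma no_early_drop:
  assumes "0 \<le> \<gamma>" "ereal \<gamma> \<le> gamma_tilde X y (\<beta>, A)" "j \<in> A"
  shows "0 \<le> move \<gamma> $ j * s $ j"
proof (cases "\<beta> $ j = 0")
  case True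
  have "0 \<le> \<gamma> * (K * (s $ j * p $ j))"
    using mult_nonneg_nonneg[OF assms(1) less_imp_le[OF mult_pos_pos[OF K_pos enter[OF assms(3) True]]]] .
  then show ?thesis
    using True by (simp add: d_eq mult_ac)
next
  case False
  have s: "s $ j \<noteq> 0" using signs_square[OF assms(3)] by auto
  then have pos: "0 < \<beta> $ j * s $ j" using agree[of j] False by (simp add: less_le)
  show ?thesis
  proof (rule ccontr)
    assume "\<not> ?thesis"
    then have lt: "\<beta> $ j * s $ j < \<gamma> * - (s $ j * d $ j)" by (simp add: algebra_simps)
    then have neg: "0 < - (s $ j * d $ j)"
      using pos mult_nonneg_nonpos[OF assms(1), of "- (s $ j * d $ j)"] by linarith
    have eq: "- \<beta> $ j / d $ j = (\<beta> $ j * s $ j) / - (s $ j * d $ j)"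
      using s by simp
    have "0 < - \<beta> $ j / d $ j"
      unfolding eq by (rule divide_pos_pos[OF pos neg])
    then have "j \<in> drop_candidates X y (\<beta>, A)"
      using assms(3) unfolding drop_candidates_def by auto
    from order_trans[OF assms(2) drop_candidate_ge[OF this]]
    have "\<gamma> \<le> - \<beta> $ j / d $ j" by (simp only: ereal_less_eq)
    then show False using lt unfolding eq pos_le_divide_eq[OF neg] by linarith
  qed
qed

lemma max_corr_move:
  assumes "0 \<le> \<gamma>" "ereal \<gamma> \<le> gamma_hat X y (\<beta>, A)"
  shows "max_corr X y (move \<gamma>) = C - \<gamma> * K"
    and "0 \<le> C - \<gamma> * K"
proof -
  obtain g where g: "gamma_hat X y (\<beta>, A) = ereal g" "0 < g" "g \<le> C / K"
    "\<And>j q. j \<notin> A \<Longrightarrow> q \<in> join_quotients X y (\<beta>, A) j \<Longrightarrow> g \<le> q"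
    by (rule gamma_hat_cases) blast
  have le: "\<gamma> \<le> g" using assms(2) g(1) by simp
  then show nonneg: "0 \<le> C - \<gamma> * K"
    using order_trans[OF le g(3)] K_pos by (simp add: pos_le_divide_eq)
  have act: "\<bar>corr X y (move \<gamma>) $ j\<bar> = C - \<gamma> * K" if "j \<in> A" for j
    using nonneg abs_signs[OF that] by (simp add: corr_move_active[OF that] abs_mult)
  obtain k where k: "k \<in> A" using nonempty by blast
  have inact: "\<bar>corr X y (move \<gamma>) $ j\<bar> \<le> C - \<gamma> * K" if "j \<notin> A" for j
    by (rule no_early_join[OF that assms(1)]) (use g(4)[OF that] le in force)
  show "max_corr X y (move \<gamma>) = C - \<gamma> * K"
  proof (rule max_corr_eqI[OF _ act[OF k]])
    show "\<bar>corr X y (move \<gamma>) $ j\<bar> \<le> C - \<gamma> * K" for j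
      using act[of j] inact[of j] by (cases "j \<in> A") auto
  qed
qed

lemma kkt_move:
  assumes "0 \<le> \<gamma>" "ereal \<gamma> \<le> min (gamma_hat X y (\<beta>, A)) (gamma_tilde X y (\<beta>, A))"
  shows "kkt X y (move \<gamma>)"
  unfolding kkt_def
proof
  fix j
  have mc: "max_corr X y (move \<gamma>) = C - \<gamma> * K"
    using max_corr_move[of \<gamma>] assms by simp
  show "move \<gamma> $ j * corr X y (move \<gamma>) $ j = max_corr X y (move \<gamma>) * \<bar>move \<gamma> $ j\<bar>"
  proof (cases "j \<in> A")
    case True
    have "\<bar>move \<gamma> $ j\<bar> = \<bar>move \<gamma> $ j * s $ j\<bar>"
      by (simp add: abs_mult abs_signs[OF True])
    then have "\<bar>move \<gamma> $ j\<bar> = move \<gamma> $ j * s $ j"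
      using no_early_drop[of \<gamma> j] assms True by simp
    then show ?thesis
      unfolding mc corr_move_active[OF True] by (simp only: mult_ac)
  next
    case False
    then show ?thesis by (simp add: d_eq inactive equi_dir_inactive)
  qed
qed

lemma step_length:
  obtains g where "min (gamma_hat X y (\<beta>, A)) (gamma_tilde X y (\<beta>, A)) = ereal g" "0 < g"
    "lars_endpoint X y (\<beta>, A) = move g"
proof -
  obtain g where g: "gamma_hat X y (\<beta>, A) = ereal g" "0 < g"
    by (rule gamma_hat_cases) blast
  obtain g' where "min (gamma_hat X y (\<beta>, A)) (gamma_tilde X y (\<beta>, A)) = ereal g'" "0 < g'"
  proof (cases "gamma_tilde X y (\<beta>, A)")
    case (real r)
    then show ?thesis using that[of "min g r"] g gamma_tilde_pos by simp
  next
    case PInf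
    then show ?thesis using that[of g] g by simp
  qed (use gamma_tilde_pos in simp)
  then show ?thesis
    using that by (simp add: lars_endpoint_def)
qed

lemma step_exists: "\<exists>S. lars_step X y (\<beta>, A) S"
proof (cases "gamma_tilde X y (\<beta>, A) < gamma_hat X y (\<beta>, A)")
  case True
  then show ?thesis
    by (cases rule: gamma_tilde_cases) (auto intro: lars_step.leave max_corr_pos)
next
  case False
  then have le: "gamma_hat X y (\<beta>, A) \<le> gamma_tilde X y (\<beta>, A)" by simp
  obtain g where g: "gamma_hat X y (\<beta>, A) = ereal g"
    "A \<noteq> UNIV \<Longrightarrow> \<exists>j. j \<notin> A \<and> g \<in> join_quotients X y (\<beta>, A) j"
    by (rule gamma_hat_cases) blast
  show ?thesis
  proof (cases "A = UNIV")
    case True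
    then show ?thesis using lars_step.full[of X y \<beta>] le max_corr_pos by blast
  next
    case False
    then obtain j where "attains_hat X y (\<beta>, A) j"
      using g by (auto simp: attains_hat_def)
    then show ?thesis using lars_step.join[of X y \<beta> A j] le max_corr_pos by blast
  qed
qed

lemma max_corr_endpoint_less: "max_corr X y (lars_endpoint X y (\<beta>, A)) < C"
proof (rule step_length)
  fix g assume "min (gamma_hat X y (\<beta>, A)) (gamma_tilde X y (\<beta>, A)) = ereal g" "0 < g"
    "lars_endpoint X y (\<beta>, A) = move g"
  then show ?thesis
    using max_corr_move(1)[of g] K_pos by (simp add: min_def split: if_splits)
qed


text \<open>
  The step is shorter than \<open>gamma_hat\<close>, so no further correlation has become maximal, and by
  uniqueness no other coefficient has vanished. The dropped index is thus the only one for which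
  anything about the next step must be shown.
\<close>

lemma leave_preserves_invariant:
  assumes "gamma_tilde X y (\<beta>, A) < gamma_hat X y (\<beta>, A)"
    and att: "attains_tilde X y (\<beta>, A) j"
    and uniq: "\<And>i. attains_tilde X y (\<beta>, A) i \<Longrightarrow> i = j"
  shows "lars_invariant X y (lars_endpoint X y (\<beta>, A)) (A - {j})"
proof -
  obtain g where "min (gamma_hat X y (\<beta>, A)) (gamma_tilde X y (\<beta>, A)) = ereal g"
    and g: "0 < g" and ep: "lars_endpoint X y (\<beta>, A) = move g"
    by (rule step_length)
  with assms(1) have tilde: "gamma_tilde X y (\<beta>, A) = ereal g"
    by (simp add: min_absorb2 less_imp_le)
  obtain gh where gh: "gamma_hat X y (\<beta>, A) = ereal gh" "gh \<le> C / K"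
    "\<And>j q. j \<notin> A \<Longrightarrow> q \<in> join_quotients X y (\<beta>, A) j \<Longrightarrow> gh \<le> q"
    by (rule gamma_hat_cases) blast
  have lt: "g < gh" using assms(1) tilde gh(1) by simp
  then have "g < C / K" using gh(2) by linarith
  then have C': "0 < C - g * K" using K_pos by (simp add: pos_less_divide_eq)
  have mc: "max_corr X y (move g) = C - g * K"
    using max_corr_move(1)[of g] g lt gh(1) by simp
  have j: "j \<in> A" "j \<in> drop_candidates X y (\<beta>, A)" "g = - \<beta> $ j / d $ j"
    using att tilde by (auto simp: attains_tilde_def drop_candidates_def)
  have neg: "s $ j * p $ j < 0"
    using drop_direction[OF j(2)] K_pos unfolding d_eq
    by (simp add: mult.left_commute[of _ K] mult_less_0_iff[of K])
  have sg: "signs X y (move g) $ i = s $ i" if "i \<in> A" for i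
    using signs_move[OF that C'] .
  \<comment> \<open>With a single active index the coefficient moves away from zero and cannot be dropped.\<close>
  have nonempty': "A - {j} \<noteq> {}"
  proof
    assume "A - {j} = {}"
    then have A: "A = insert j {}" using j(1) by auto
    have "0 < s $ j * equi_dir X s (insert j {}) $ j"
    proof (rule entering_direction_pos)
      have "equi_dir X s {} = 0" by (simp add: vec_eq_iff equi_dir_inactive)
      then show "s $ j * gram_mult X (equi_dir X s {}) $ j < 1" by (simp add: gram_mult_zero)
    qed (use signs_square A in auto)
    then show False using neg A by simp
  qed
  have active': "\<bar>corr X y (move g) $ i\<bar> = C - g * K" if "i \<in> A - {j}" for i
    using that C' by (simp add: corr_move_active abs_mult abs_signs)
  have zero: "move g $ i = 0" if "i \<notin> A - {j}" for i
  proof (cases "i = j")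
    case True
    have "d $ j \<noteq> 0" using neg K_pos by (auto simp: d_eq)
    then show ?thesis using True j(3) by simp
  next
    case False
    then show ?thesis using that by (simp add: d_eq inactive equi_dir_inactive)
  qed
  have agree': "0 \<le> move g $ i * signs X y (move g) $ i" for i
  proof (cases "i \<in> A - {j}")
    case True
    then show ?thesis using no_early_drop[of g i] g tilde sg[of i] by auto
  next
    case False
    show ?thesis unfolding zero[OF False] by simp
  qed
  have enter': "0 < signs X y (move g) $ i * equi_dir X (signs X y (move g)) (A - {j}) $ i"
    if "i \<in> A - {j}" and 0: "move g $ i = 0" for i
  proof -
    have "i \<in> A" using that by simp
    from drop_hit[OF this g 0] have "attains_tilde X y (\<beta>, A) i"
      by (simp add: attains_tilde_def tilde)
    then show ?thesis using uniq that by blast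
  qed
  have exit': "1 < signs X y (move g) $ i * gram_mult X (equi_dir X (signs X y (move g)) (A - {j})) $ i"
    if i: "i \<notin> A - {j}" "\<bar>corr X y (move g) $ i\<bar> = C - g * K" for i
  proof (cases "i = j")
    case True
    have "1 < s $ j * gram_mult X (equi_dir X (signs X y (move g)) (A - {j})) $ j"
    proof (rule leaving_correlation_falls)
      show "s $ j * equi_dir X s (insert j (A - {j})) $ j < 0"
        using neg j(1) by (simp add: insert_absorb)
    qed (use j(1) signs_square sg in auto)
    then show ?thesis using True sg[OF j(1)] by simp
  next
    case False
    then have "i \<notin> A" using i(1) by simp
    moreover have "\<exists>\<sigma>\<in>{1, -1}. \<sigma> * corr X y (move g) $ i = C - g * K"
      using i(2) by (auto simp: abs_if split: if_splits)
    ultimately have "g \<in> join_quotients X y (\<beta>, A) i"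
      using join_quotients_iff[of i g] g by blast
    then show ?thesis using gh(3)[OF \<open>i \<notin> A\<close>] lt by fastforce
  qed
  show ?thesis
    unfolding ep
    by (unfold_locales, unfold mc) (fact C' nonempty' active' zero agree' enter' exit')+
qed

text \<open>
  Dual to the previous case: no active coefficient vanishes at the end of the step, and by
  uniqueness the joining index is the only new one with maximal correlation.
\<close>

lemma join_preserves_invariant:
  assumes "gamma_hat X y (\<beta>, A) < gamma_tilde X y (\<beta>, A)"
    and att: "attains_hat X y (\<beta>, A) j"
    and uniq: "\<And>i. attains_hat X y (\<beta>, A) i \<Longrightarrow> i = j"
    and pos: "0 < max_corr X y (lars_endpoint X y (\<beta>, A))"
  shows "lars_invariant X y (lars_endpoint X y (\<beta>, A)) (insert j A)"
proof -
  obtain g where "min (gamma_hat X y (\<beta>, A)) (gamma_tilde X y (\<beta>, A)) = ereal g"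
    and g: "0 < g" and ep: "lars_endpoint X y (\<beta>, A) = move g"
    by (rule step_length)
  with assms(1) have hat: "gamma_hat X y (\<beta>, A) = ereal g"
    by (simp add: min_def split: if_splits)
  have mc: "max_corr X y (move g) = C - g * K"
    using max_corr_move(1)[of g] g hat by simp
  then have C': "0 < C - g * K" using pos by (simp add: ep)
  have j: "j \<notin> A" "g \<in> join_quotients X y (\<beta>, A) j"
    using att hat by (auto simp: attains_hat_def)
  have sg: "signs X y (move g) $ i = s $ i" if "i \<in> A" for i
    using signs_move[OF that C'] .
  obtain \<sigma> where \<sigma>: "\<sigma> \<in> {1, -1}" "\<sigma> * corr X y (move g) $ j = C - g * K"
    using j join_quotients_iff by blast
  have sj: "signs X y (move g) $ j = \<sigma>"
    using \<sigma> C' by (auto simp: signs_def sgn_if)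
  have cj: "\<bar>corr X y (move g) $ j\<bar> = C - g * K"
    using \<sigma> C' by auto
  have lt: "\<sigma> * h $ j < 1"
    using join_crossing[OF j(1) g \<sigma>] .
  have nonempty': "insert j A \<noteq> {}" by simp
  have active': "\<bar>corr X y (move g) $ i\<bar> = C - g * K" if "i \<in> insert j A" for i
    using that C' cj by (auto simp: corr_move_active abs_mult abs_signs)
  have zero: "move g $ i = 0" if "i \<notin> A" for i
    using that by (simp add: d_eq inactive equi_dir_inactive)
  have inactive': "move g $ i = 0" if "i \<notin> insert j A" for i
    using zero[of i] that by blast
  have agree': "0 \<le> move g $ i * signs X y (move g) $ i" for i
  proof (cases "i \<in> A")
    case True
    then show ?thesis using no_early_drop[of g i] g hat assms(1) sg[of i] by auto
  next
    case False
    show ?thesis unfolding zero[OF False] by simp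
  qed
  have enter': "0 < signs X y (move g) $ i *
      equi_dir X (signs X y (move g)) (insert j A) $ i"
    if "i \<in> insert j A" "move g $ i = 0" for i
  proof (cases "i = j")
    case True
    show ?thesis unfolding True
    proof (rule entering_direction_pos)
      show "signs X y (move g) $ j * gram_mult X p $ j < 1" using lt sj by simp
      show "signs X y (move g) $ i * signs X y (move g) $ i = 1" if "i \<in> insert j A" for i
        using that \<sigma>(1) signs_square sg sj by auto
    qed (use j(1) sg in auto)
  next
    case False
    then have "gamma_tilde X y (\<beta>, A) \<le> ereal g"
      using drop_hit_ge[OF _ g] that by blast
    then show ?thesis using assms(1) hat by simp
  qed
  have exit': "1 < signs X y (move g) $ i *
      gram_mult X (equi_dir X (signs X y (move g)) (insert j A)) $ i"
    if i: "i \<notin> insert j A" "\<bar>corr X y (move g) $ i\<bar> = C - g * K" for i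
  proof -
    have "\<exists>\<sigma>\<in>{1, -1}. \<sigma> * corr X y (move g) $ i = C - g * K"
      using i(2) by (auto simp: abs_if split: if_splits)
    then have "attains_hat X y (\<beta>, A) i"
      using join_quotients_iff[of i g] g i(1) by (simp add: attains_hat_def hat)
    then show ?thesis using uniq i(1) by blast
  qed
  show ?thesis
    unfolding ep
    by (unfold_locales, unfold mc) (fact C' nonempty' active' inactive' agree' enter' exit')+
qed

text \<open>
  A state with the same active set and signs lies on the line of the current step, because its
  correlations on \<open>A\<close> determine its coefficients. If its maximal correlation were below that of the
  endpoint, it would lie strictly beyond the endpoint, where the index that ended the step
  violates the optimality condition. If all indices are active and the step ends at correlation
  zero, nothing can lie beyond.
\<close>

lemma no_return:
  assumes "lars_invariant X y \<beta>' A"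
    and agree': "\<And>j. j \<in> A \<Longrightarrow> signs X y \<beta>' $ j = s $ j"
  shows "max_corr X y (lars_endpoint X y (\<beta>, A)) \<le> max_corr X y \<beta>'"
proof (rule ccontr)
  interpret later: lars_invariant X y \<beta>' A by fact
  assume "\<not> ?thesis"
  then have less: "later.C < max_corr X y (lars_endpoint X y (\<beta>, A))" by simp
  obtain g where min: "min (gamma_hat X y (\<beta>, A)) (gamma_tilde X y (\<beta>, A)) = ereal g"
    and g: "0 < g" and ep: "lars_endpoint X y (\<beta>, A) = move g"
    by (rule step_length)
  have mc: "max_corr X y (move g) = C - g * K"
    by (rule max_corr_move) (use g min in \<open>auto simp: min_def split: if_splits\<close>)
  \<comment> \<open>The time at which the current line reaches the maximal correlation of the other state.\<close>
  define \<gamma> where "\<gamma> = (C - later.C) / K"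
  have \<gamma>K: "\<gamma> * K = C - later.C" using K_pos by (simp add: \<gamma>_def)
  have "g * K < \<gamma> * K" using less mc ep \<gamma>K by simp
  then have \<gamma>: "g < \<gamma>" using K_pos by simp
  have "\<beta>' - move \<gamma> = 0"
  proof (rule gram_block_nonsingular[of A])
    show "(\<beta>' - move \<gamma>) $ j = 0" if "j \<notin> A" for j
      using that by (simp add: d_eq inactive later.inactive equi_dir_inactive)
    show "gram_mult X (\<beta>' - move \<gamma>) $ j = 0" if "j \<in> A" for j
    proof -
      have "corr X y \<beta>' $ j = corr X y (move \<gamma>) $ j - gram_mult X (\<beta>' - move \<gamma>) $ j"
        using corr_add[of X y "move \<gamma>" "\<beta>' - move \<gamma>"] by simp
      then show ?thesis
        using corr_move_active[OF that, of \<gamma>] later.corr_eq[OF that] agree'[OF that] \<gamma>K by simp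
    qed
  qed
  then have \<beta>': "\<beta>' = move \<gamma>" by simp
  obtain gh where gh: "gamma_hat X y (\<beta>, A) = ereal gh"
    "A = UNIV \<Longrightarrow> gh = C / K"
    "A \<noteq> UNIV \<Longrightarrow> \<exists>j. j \<notin> A \<and> gh \<in> join_quotients X y (\<beta>, A) j"
    by (rule gamma_hat_cases) blast
  show False
  proof (cases "gamma_tilde X y (\<beta>, A) < gamma_hat X y (\<beta>, A)")
    case True
    then have tilde: "gamma_tilde X y (\<beta>, A) = ereal g" using min by (simp add: min_absorb2 less_imp_le)
    then obtain j where j: "j \<in> drop_candidates X y (\<beta>, A)" "g = - \<beta> $ j / d $ j"
      by (cases rule: gamma_tilde_cases) (auto simp: attains_tilde_def)
    have neg: "s $ j * d $ j < 0" using drop_direction[OF j(1)] .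
    then have "\<beta> $ j + g * d $ j = 0" using j(2) by auto
    then have "\<beta>' $ j = (\<gamma> - g) * d $ j" unfolding \<beta>' by (simp add: algebra_simps)
    moreover have "j \<in> A" using j(1) by (simp add: drop_candidates_def)
    ultimately have "0 \<le> (\<gamma> - g) * (s $ j * d $ j)"
      using later.agree[of j] agree'[of j] by (simp add: mult_ac)
    moreover have "(\<gamma> - g) * (s $ j * d $ j) < 0" by (rule mult_pos_neg[OF _ neg]) (use \<gamma> in simp)
    ultimately show False by linarith
  next
    case False
    then have g_eq: "g = gh" using min gh(1) by (simp add: min_def split: if_splits)
    show False
    proof (cases "A = UNIV")
      case True
      then have "C < \<gamma> * K" using \<gamma> g_eq gh(2) K_pos by (simp add: pos_divide_less_eq)
      then show False using \<gamma>K later.max_corr_pos by simp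
    next
      case False
      then obtain j where j: "j \<notin> A" "g \<in> join_quotients X y (\<beta>, A) j"
        using gh(3) g_eq by blast
      then obtain \<sigma> where \<sigma>: "\<sigma> \<in> {1, -1}" "\<sigma> * corr X y (move g) $ j = C - g * K"
        using join_quotients_iff by blast
      have "\<sigma> * h $ j < 1" using join_crossing[OF j(1) g \<sigma>] .
      then have "(\<gamma> - g) * K * (\<sigma> * h $ j) < (\<gamma> - g) * K * 1"
        using \<gamma> K_pos by (intro mult_strict_left_mono) auto
      then have "C - \<gamma> * K < \<sigma> * corr X y \<beta>' $ j"
        using \<sigma>(2) unfolding \<beta>' corr_move by (simp add: algebra_simps)
      then have "later.C < \<sigma> * corr X y \<beta>' $ j" using \<gamma>K by simp
      then show False using corr_le_max_corr[of X y \<beta>' j] \<sigma>(1) by auto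
    qed
  qed
qed

end

section \<open>Termination and coverage of all bounds\<close>

lemma kkt_zero: "kkt X y 0"
  by (simp add: kkt_def)

lemma kkt_max_corr_zero:
  assumes "max_corr X y \<beta> = 0"
  shows "kkt X y \<beta>"
proof -
  have "corr X y \<beta> $ j = 0" for j
    using corr_le_max_corr[of X y \<beta> j] assms by simp
  then show ?thesis by (simp add: kkt_def assms)
qed

lemma lars_step_endpoint:
  "lars_step X y S S' \<Longrightarrow> fst S' = lars_endpoint X y S \<and> 0 < max_corr X y (fst S)"
  by (erule lars_step.cases) simp_all

locale lars_run = full_rank_design X y for X :: "real ^ 'm ^ 'n" and y +
  assumes one_at_a_time: "one_at_a_time X y"
begin

lemma lars_invariant_init:
  assumes "0 < max_corr X y 0"
  shows "lars_invariant X y 0 {j. \<bar>corr X y 0 $ j\<bar> = max_corr X y 0}"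
proof -
  let ?A = "{j. \<bar>corr X y 0 $ j\<bar> = max_corr X y 0}" and ?s = "signs X y 0"
  have "is_singleton ?A"
    using mp[OF conjunct1[OF one_at_a_time[unfolded one_at_a_time_def]] assms]
    by (simp add: lars_init_def)
  then obtain k where k: "?A = {k}" by (rule is_singletonE)
  have corr_k: "\<bar>corr X y 0 $ j\<bar> = max_corr X y 0 \<longleftrightarrow> j = k" for j
    using arg_cong[OF k, of "\<lambda>A. j \<in> A"] by simp
  have "corr X y 0 $ k \<noteq> 0" using assms corr_k[of k] by auto
  then have sk: "?s $ k * ?s $ k = 1" by (auto simp: signs_def sgn_if)
  have "0 < ?s $ k * equi_dir X ?s (insert k {}) $ k"
  proof (rule entering_direction_pos)
    have "equi_dir X ?s {} = 0" by (simp add: vec_eq_iff equi_dir_inactive)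
    then show "?s $ k * gram_mult X (equi_dir X ?s {}) $ k < 1" by (simp add: gram_mult_zero)
  qed (use sk in auto)
  then show ?thesis
    unfolding k using assms corr_k by unfold_locales simp_all
qed

text \<open>
  If the correlation is still positive at the end of a step, the one-at-a-time condition makes the
  two step lengths different and the index that ends the step unique. A full active set then
  leaves by a drop, since there is no index to join.
\<close>

lemma reachable_invariant:
  assumes "lars_reachable X y S" and "0 < max_corr X y (fst S)"
  shows "lars_invariant X y (fst S) (snd S)"
  using assms unfolding lars_reachable_def
proof (induction rule: rtranclp_induct)
  case base
  then show ?case using lars_invariant_init by (simp add: lars_init_def)
next
  case (step S S')
  have reach: "lars_reachable X y S" using step.hyps(1) by (simp add: lars_reachable_def)
  have ep: "fst S' = lars_endpoint X y S" and pos: "0 < max_corr X y (fst S)"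
    using lars_step_endpoint[OF step.hyps(2)] by auto
  interpret lars_invariant X y "fst S" "snd S" using step.IH pos .
  have pos': "0 < max_corr X y (lars_endpoint X y S)" using step.prems ep by simp
  note tie_free = mp[OF spec[OF conjunct2[OF one_at_a_time[unfolded one_at_a_time_def]], of S],
      OF conjI[OF reach conjI[OF pos pos']]]
  have 1: "gamma_tilde X y S \<noteq> gamma_hat X y S"
    "gamma_tilde X y S < gamma_hat X y S \<Longrightarrow> \<exists>!j. attains_tilde X y S j"
    "gamma_hat X y S < gamma_tilde X y S \<Longrightarrow> \<exists>!j. attains_hat X y S j"
    using tie_free by simp_all
  from step.hyps(2) show ?case
  proof cases
    case (leave \<beta> A j)
    have lt: "gamma_tilde X y S < gamma_hat X y S" and att: "attains_tilde X y S j"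
      and S': "snd S' = snd S - {j}"
      using leave by simp_all
    have uniq: "i = j" if "attains_tilde X y S i" for i
      using the1_equality[OF 1(2)[OF lt] that] the1_equality[OF 1(2)[OF lt] att] by simp
    have "lars_invariant X y (lars_endpoint X y S) (snd S - {j})"
      by (rule leave_preserves_invariant[unfolded prod.collapse]) (fact lt att uniq)+
    then show ?thesis by (simp only: S' ep)
  next
    case (join \<beta> A j)
    have att: "attains_hat X y S j" and S': "snd S' = insert j (snd S)"
      using join by simp_all
    have "gamma_hat X y S \<le> gamma_tilde X y S" using join by simp
    then have lt: "gamma_hat X y S < gamma_tilde X y S" using 1(1) by (simp add: less_le)
    have uniq: "i = j" if "attains_hat X y S i" for i
      using the1_equality[OF 1(3)[OF lt] that] the1_equality[OF 1(3)[OF lt] att] by simp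
    have "lars_invariant X y (lars_endpoint X y S) (insert j (snd S))"
      by (rule join_preserves_invariant[unfolded prod.collapse]) (fact lt att uniq pos')+
    then show ?thesis by (simp only: S' ep)
  next
    case (full \<beta>)
    have "gamma_hat X y S \<le> gamma_tilde X y S" using full by simp
    then have lt: "gamma_hat X y S < gamma_tilde X y S" using 1(1) by (simp add: less_le)
    obtain j where "attains_hat X y S j" using ex1_implies_ex[OF 1(3)[OF lt]] by (rule exE)
    then show ?thesis unfolding full(1) by (simp add: attains_hat_def)
  qed
qed

lemma trace_kkt:
  assumes "b \<in> lars_trace X y"
  shows "kkt X y b"
proof (cases "b = 0")
  case True
  then show ?thesis by (simp add: kkt_zero)
next
  case False
  then have "b \<in> (\<Union>S\<in>{S. lars_reachable X y S \<and> 0 < max_corr X y (fst S)}. lars_segment X y S)"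
    using assms unfolding lars_trace_def by (simp only: Un_iff singleton_iff simp_thms)
  then obtain S where "S \<in> {S. lars_reachable X y S \<and> 0 < max_corr X y (fst S)}"
    and segment: "b \<in> lars_segment X y S"
    by (rule UN_E)
  then have S: "lars_reachable X y S" "0 < max_corr X y (fst S)"
    by simp_all
  interpret lars_invariant X y "fst S" "snd S" using reachable_invariant[OF S] .
  obtain \<gamma> where "b = fst S + \<gamma> *\<^sub>R lars_dir X y S" "0 \<le> \<gamma>"
    "ereal \<gamma> \<le> min (gamma_hat X y S) (gamma_tilde X y S)"
    using segment unfolding lars_segment_def by blast
  then show ?thesis
    using kkt_move[of \<gamma>] by (simp only: prod.collapse)
qed

text \<open>
  Each step contributes the values between the norms of its two endpoints, by the intermediate
  value theorem.
\<close>

lemma trace_covers: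
  assumes "lars_reachable X y S" "0 \<le> t" "t \<le> l1_norm (fst S)"
  shows "\<exists>b\<in>lars_trace X y. l1_norm b = t"
  using assms unfolding lars_reachable_def
proof (induction rule: rtranclp_induct)
  case base
  then have "l1_norm 0 = t" by (simp add: lars_init_def l1_norm_def)
  then show ?case by (auto simp: lars_trace_def)
next
  case (step S S')
  show ?case
  proof (cases "t \<le> l1_norm (fst S)")
    case True
    then show ?thesis using step by blast
  next
    case False
    have reach: "lars_reachable X y S" using step.hyps(1) by (simp add: lars_reachable_def)
    have ep: "fst S' = lars_endpoint X y S" and pos: "0 < max_corr X y (fst S)"
      using lars_step_endpoint[OF step.hyps(2)] by auto
    interpret lars_invariant X y "fst S" "snd S" using reachable_invariant[OF reach pos] .
    obtain g where g: "min (gamma_hat X y S) (gamma_tilde X y S) = ereal g" "0 < g"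
      "lars_endpoint X y S = fst S + g *\<^sub>R lars_dir X y S"
      using step_length by auto
    let ?f = "\<lambda>\<gamma>. l1_norm (fst S + \<gamma> *\<^sub>R lars_dir X y S)"
    have "\<exists>\<gamma>\<ge>0. \<gamma> \<le> g \<and> ?f \<gamma> = t"
    proof (rule IVT')
      show "continuous_on {0..g} ?f" unfolding l1_norm_def by (intro continuous_intros)
    qed (use False step.prems g ep in auto)
    then obtain \<gamma> where \<gamma>: "0 \<le> \<gamma>" "\<gamma> \<le> g" "?f \<gamma> = t" by blast
    then have "fst S + \<gamma> *\<^sub>R lars_dir X y S \<in> lars_segment X y S"
      unfolding lars_segment_def using g(1) by auto
    then have "fst S + \<gamma> *\<^sub>R lars_dir X y S \<in> lars_trace X y"
      using reach pos unfolding lars_trace_def by (intro UnI2 UN_I[of S]) auto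
    then show ?thesis using \<gamma>(3) by blast
  qed
qed

lemma max_corr_step_less:
  assumes "lars_reachable X y S" "lars_step X y S S'"
  shows "max_corr X y (fst S') < max_corr X y (fst S)"
proof -
  have ep: "fst S' = lars_endpoint X y S" and pos: "0 < max_corr X y (fst S)"
    using lars_step_endpoint[OF assms(2)] by auto
  interpret lars_invariant X y "fst S" "snd S" using reachable_invariant[OF assms(1) pos] .
  show ?thesis using max_corr_endpoint_less ep by simp
qed

lemma step_active_set_neq:
  assumes "lars_reachable X y S" "lars_step X y S S'" "0 < max_corr X y (fst S')"
  shows "snd S' \<noteq> snd S"
  using assms(2)
proof cases
  case (leave \<beta> A j)
  then show ?thesis by (auto simp: attains_tilde_def drop_candidates_def)
next
  case (join \<beta> A j)
  then show ?thesis by (auto simp: attains_hat_def)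
next
  case (full \<beta>)
  interpret lars_invariant X y \<beta> UNIV
    using reachable_invariant[OF assms(1)] full by simp
  have hat: "gamma_hat X y (\<beta>, UNIV) = ereal (C / K)" by (simp add: gamma_hat_def)
  then have "lars_endpoint X y (\<beta>, UNIV) = move (C / K)"
    using full by (simp add: lars_endpoint_def min_def)
  moreover have "max_corr X y (move (C / K)) = 0"
    using max_corr_move(1)[of "C / K"] hat K_pos max_corr_pos by simp
  ultimately show ?thesis using assms(3) full by simp
qed

text \<open>
  In an infinite run two states would share active set and signs. The maximal correlation decreases
  strictly, so \<open>no_return\<close> forces the second to be the immediate successor of the first, but a step
  that does not end at correlation zero changes the active set.
\<close>

lemma run_terminates: "\<exists>S. lars_reachable X y S \<and> max_corr X y (fst S) = 0"
proof (rule ccontr)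
  assume "\<not> ?thesis"
  then have "max_corr X y (fst S) \<noteq> 0" if "lars_reachable X y S" for S
    using that by blast
  then have pos: "0 < max_corr X y (fst S)" if "lars_reachable X y S" for S
    using that max_corr_nonneg[of X y "fst S"] by (simp add: less_le)
  have continues: "\<exists>S'. lars_reachable X y S' \<and> lars_step X y S S'" if "lars_reachable X y S" for S
  proof -
    interpret lars_invariant X y "fst S" "snd S" using reachable_invariant[OF that pos[OF that]] .
    obtain S' where "lars_step X y S S'" using step_exists by auto
    then show ?thesis
      using that unfolding lars_reachable_def by (meson rtranclp.rtrancl_into_rtrancl)
  qed
  have "lars_reachable X y (lars_init X y)" by (simp add: lars_reachable_def)
  then obtain f where f: "\<And>n. lars_reachable X y (f n)" "\<And>n. lars_step X y (f n) (f (Suc n))"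
    using dependent_nat_choice[of "\<lambda>_. lars_reachable X y" "\<lambda>_. lars_step X y"] continues by blast
  \<comment> \<open>On the active set the signs are \<open>\<plusminus>1\<close>, so the positive ones determine them all.\<close>
  define key where "key n = (snd (f n), {j \<in> snd (f n). signs X y (fst (f n)) $ j = 1})" for n
  have "\<not> inj key"
    using finite_imageD[of key UNIV] by (auto simp: finite_subset[OF subset_UNIV])
  then obtain m n where "key m = key n" "m \<noteq> n" unfolding inj_def by blast
  then obtain m n where mn: "m < n" and key: "key m = key n"
    by (metis nat_neq_iff)
  have dec: "max_corr X y (fst (f j)) < max_corr X y (fst (f i))" if "i < j" for i j
    using that
  proof (induction rule: strict_inc_induct)
    case (base i)
    then show ?case using max_corr_step_less f by blast
  next
    case (step i)
    then show ?case using max_corr_step_less[OF f(1,2), of i] by linarith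
  qed
  interpret lars_invariant X y "fst (f m)" "snd (f m)"
    using reachable_invariant[OF f(1) pos[OF f(1)]] .
  have A: "snd (f n) = snd (f m)" using key by (simp add: key_def)
  interpret later: lars_invariant X y "fst (f n)" "snd (f m)"
    using reachable_invariant[OF f(1) pos[OF f(1)], of n] A by simp
  have "later.s $ j = s $ j" if "j \<in> snd (f m)" for j
  proof -
    have "later.s $ j = 1 \<longleftrightarrow> s $ j = 1" using key A that by (auto simp: key_def)
    then show ?thesis
      using abs_signs[OF that] later.abs_signs[OF that] by (auto simp: abs_if split: if_splits)
  qed
  then have "max_corr X y (lars_endpoint X y (f m)) \<le> max_corr X y (fst (f n))"
    using no_return[OF later.lars_invariant_axioms] by simp
  then have le: "max_corr X y (fst (f (Suc m))) \<le> max_corr X y (fst (f n))"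
    using lars_step_endpoint[OF f(2)] by simp
  have "n = Suc m"
    using dec[of "Suc m" n] le mn by (metis Suc_lessI linorder_not_less)
  then show False
    using step_active_set_neq[OF f(1,2) pos[OF f(1)]] A by blast
qed

text \<open>
  Bounds up to the norm of the final coefficients are met by the trace with equality. For larger
  bounds the final coefficients are optimal since their residual has no correlation left; they lie
  on the trace because the solution for a given bound is unique.
\<close>

theorem lars_trace_eq_lasso_path:
  "(\<forall>t\<ge>0. \<exists>!\<beta>. lasso_solution X y t \<beta>) \<and> lars_trace X y = {lasso X y t |t. t \<ge> 0}"
proof -
  obtain S where S: "lars_reachable X y S" "max_corr X y (fst S) = 0"
    using run_terminates by blast
  have sol: "\<exists>b\<in>lars_trace X y. \<forall>\<beta>. lasso_solution X y t \<beta> \<longleftrightarrow> \<beta> = b" if t: "0 \<le> t" for t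
  proof (cases "t \<le> l1_norm (fst S)")
    case True
    then obtain b where "b \<in> lars_trace X y" "l1_norm b = t"
      using trace_covers[OF S(1) t True] by blast
    then show ?thesis using kkt_imp_lasso_solution_iff[OF trace_kkt, of b t] by blast
  next
    case False
    have kkt: "kkt X y (fst S)" using kkt_max_corr_zero[OF S(2)] .
    have "0 \<le> l1_norm (fst S)" by (simp add: l1_norm_def sum_nonneg)
    then obtain b where b: "b \<in> lars_trace X y" "l1_norm b = l1_norm (fst S)"
      using trace_covers[OF S(1) _ order_refl] by blast
    then have "b = fst S"
      using kkt_imp_lasso_solution_iff[OF trace_kkt, of b "l1_norm b" b]
        kkt_imp_lasso_solution_iff[OF kkt, of "l1_norm b" b] by simp
    then show ?thesis
      using b(1) kkt_imp_lasso_solution_iff[OF kkt, of t] S(2) False by auto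
  qed
  have lasso: "lasso X y t = b" if "\<forall>\<beta>. lasso_solution X y t \<beta> \<longleftrightarrow> \<beta> = b" for t b
    using that by (simp add: lasso_def)
  have "b = lasso X y (l1_norm b)" "0 \<le> l1_norm b" if "b \<in> lars_trace X y" for b
    using lasso[of "l1_norm b" b] kkt_imp_lasso_solution_iff[OF trace_kkt[OF that]]
    by (auto simp: l1_norm_def sum_nonneg)
  then have "lars_trace X y \<subseteq> {lasso X y t |t. t \<ge> 0}" by blast
  moreover have "{lasso X y t |t. t \<ge> 0} \<subseteq> lars_trace X y"
    using sol lasso by force
  moreover have "\<exists>!\<beta>. lasso_solution X y t \<beta>" if "0 \<le> t" for t
    using sol[OF that] by auto
  ultimately show ?thesis by blast
qed

end

lemma independent_columns_full_rank:
  fixes X :: "real ^ 'm ^ 'n"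
  assumes "inj (\<lambda>j. column j X)" "independent (columns X)" "X *v b = 0"
  shows "b = 0"
proof -
  let ?r = "inv (\<lambda>j. column j X)"
  have cols: "columns X = range (\<lambda>j. column j X)" by (auto simp: columns_def)
  have "(\<Sum>v\<in>columns X. b $ ?r v *\<^sub>R v) = (\<Sum>j\<in>UNIV. b $ j *\<^sub>R column j X)"
    unfolding cols by (subst sum.reindex[OF assms(1)]) (simp add: inv_f_f[OF assms(1)])
  also have "\<dots> = 0"
    using assms(3) by (simp add: matrix_mult_sum scalar_mult_eq_scaleR)
  finally have 0: "(\<Sum>v\<in>columns X. b $ ?r v *\<^sub>R v) = 0" .
  have "b $ j = 0" for j
  proof -
    have "b $ ?r (column j X) = 0"
      by (rule independentD[OF assms(2) _ order_refl 0]) (auto simp: cols)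
    then show ?thesis using inv_f_f[OF assms(1), of j] by simp
  qed
  then show ?thesis by (simp add: vec_eq_iff)
qed

theorem theorem1:
  fixes X :: "real ^ 'm ^ 'n" and y :: "real ^ 'n"
  assumes "inj (\<lambda>j. column j X)" and "independent (columns X)"
    and "(\<Sum>i\<in>UNIV. y $ i) = 0"
    and "\<And>j. (\<Sum>i\<in>UNIV. X $ i $ j) = 0"
    and "\<And>j. (\<Sum>i\<in>UNIV. (X $ i $ j)\<^sup>2) = 1"
    and "one_at_a_time X y"
  shows "(\<forall>t\<ge>0. \<exists>!\<beta>. lasso_solution X y t \<beta>) \<and>
    lars_trace X y = {lasso X y t |t. t \<ge> 0}"
proof -
  interpret lars_run X y
    by unfold_locales (use independent_columns_full_rank[OF assms(1,2)] assms(6) in auto)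
  show ?thesis by (rule lars_trace_eq_lasso_path)
qed

end
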